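(* Assume the setting described in the context. For every $v\in\{0,\dots,\tau-1\}$ and every integer $u\ge 1$, $$Q_{v,u}-Q_{v+1,u-1}=l^{\overline{E}_{v+u,u-1}}\,b_{v+u+1,u},$$ and the $\mathbf l$-adic digit $b_{v+u+1,u}$ satisfies $$b_{v+u+1,u}=\frac{l^{e_v}d_{v,u}-d_{v+1,u-1}+b_{v+u,u-1}}{m^{f_{v+u}}}.$$
   Context: Setting. Let $m,l\ge 2$ be coprime integers and $\tau\ge1$ an integer. Let $f_0,\dots,f_{\tau-1}$ be positive integers. Let $(a_{v,i})$, $v\in\{0,\dots,\tau-1\}$, $i\in\{0,\dots,l-1\}$, be integers with $a_{v,0}=0$ and, for $i\neq0$: $a_{v,i}\equiv -m^{f_v}i \pmod l$, $a_{v,i}\not\equiv0\pmod m$ and $a_{v,i}\not\equiv 0\pmod l$. For each $v\in\{0,\dots,\tau-1\}$ fix an admissible choice: an index $i_v\in\{1,\dots,l-1\}$, with $a_v:=a_{v,i_v}$; an integer $s_v$ with $1\le s_v\le m^{f_v}-1$ and $\gcd(s_v,m)=1$; and positive integers $e_v,r_v$ with $r_v\equiv i_v\pmod l$, $l^{e_v}s_v=m^{f_v}r_v+a_v$, and $|a_v|<\max(m^{f_v},l^{e_v})$. All indexed quantities are extended $\tau$-periodically to all integer indices ($f_u=f_{u\bmod\tau}$, $e_u=e_{u\bmod \tau}$, $s_u,r_u,a_u$ likewise). Sums. For $v\in\mathbb Z$, $u\ge0$: $F_{v,u}=\sum_{y=0}^{u-1}f_{v+y}$, $E_{v,u}=\sum_{y=0}^{u-1}e_{v+y}$,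 $\overline{F}_{v,u}=\sum_{y=0}^{u-1}f_{v-1-y}$, $\overline{E}_{v,u}=\sum_{y=0}^{u-1}e_{v-1-y}$. Iterates. Let $\mathbb Z_{\langle m,l\rangle}$ be the subring of $\mathbb Q$ of fractions whose denominators are coprime to both $m$ and $l$ (congruences modulo powers of $m$, $l$ are taken in this ring). Let $(n_v)_{v\in\mathbb Z}$ be a $\tau$-periodic sequence in $\mathbb Z_{\langle m,l\rangle}$ with $n_v\equiv s_v\pmod{m^{f_v}}$ and $n_{v+1}=l^{e_v}\frac{n_v-s_v}{m^{f_v}}+r_v$ for all $v$. Graded digits. For each $v$ define $k_{v,0}=n_v$ and, for $u\ge0$, $k_{v,u}=m^{f_{v+u}}k_{v,u+1}+d_{v,u}$ with $d_{v,u}\in\{0,\dots,m^{f_{v+u}}-1\}$ and $k_{v,u+1}\in\mathbb Z_{\langle m,l\rangle}$ (the $u$-th $\mathbf m$-adic digit and quotient of $n_v$). Define $j_{v,0}=n_v$ and $j_{v,u}=l^{e_{v-1-u}}j_{v,u+1}+b_{v,u}$ with $b_{v,u}\in\{0,\dots,l^{e_{v-1-u}}-1\}$ and $j_{v,u+1}\in\mathbb Z_{\langle m,l\rangle}$ (the $u$-th $\mathbf l$-adic digit and quotient of $n_v$). Prefix addends. $Q_{v,0}=0$ and for $u\ge1$, $Q_{v,u}=\dfrac{l^{E_{v,u}}d_{v,u}+l^{e_{v+u-1}}Q_{v,u-1}-s_{v+u}+r_{v+u-1}}{m^{f_{v+u}}}$. *)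

theory Defs
  imports Complex_Main "HOL-Number_Theory.Cong" "HOL-Library.Periodic_Fun"
begin

definition Zfrac :: "int \<Rightarrow> int \<Rightarrow> rat set" where
  "Zfrac m l = {of_int p / of_int q | p q. q \<noteq> 0 \<and> coprime q m \<and> coprime q l}"

definition cong_in :: "rat set \<Rightarrow> rat \<Rightarrow> rat \<Rightarrow> rat \<Rightarrow> bool" where
  "cong_in R x y M \<longleftrightarrow> (\<exists>z\<in>R. x - y = M * z)"

(* Sequences that the text indexes by 0..tau-1 and extends periodically are functions on int
   with period tau (locale predicate periodic_fun_simple). *)

definition forward_sum :: "(int \<Rightarrow> nat) \<Rightarrow> int \<Rightarrow> nat \<Rightarrow> nat" where
  "forward_sum g v u = (\<Sum>y<u. g (v + int y))"

definition backward_sum :: "(int \<Rightarrow> nat) \<Rightarrow> int \<Rightarrow> nat \<Rightarrow> nat" where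
  "backward_sum g v u = (\<Sum>y<u. g (v - 1 - int y))"

(* k and d are the quotients and digits of x in R with respect to the mixed radices w 0, w 1, ... *)

definition digit_expansion ::
  "rat set \<Rightarrow> (nat \<Rightarrow> int) \<Rightarrow> rat \<Rightarrow> (nat \<Rightarrow> rat) \<Rightarrow> (nat \<Rightarrow> int) \<Rightarrow> bool" where
  "digit_expansion R w x k d \<longleftrightarrow>
     k 0 = x \<and>
     (\<forall>u. k u = of_int (w u) * k (Suc u) + of_int (d u) \<and> d u \<in> {0..w u - 1} \<and> k (Suc u) \<in> R)"

primrec prefix_addend ::
  "int \<Rightarrow> int \<Rightarrow> (int \<Rightarrow> nat) \<Rightarrow> (int \<Rightarrow> nat) \<Rightarrow> (int \<Rightarrow> int) \<Rightarrow> (int \<Rightarrow> int) \<Rightarrow>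
   (int \<Rightarrow> nat \<Rightarrow> int) \<Rightarrow> int \<Rightarrow> nat \<Rightarrow> rat" where
  "prefix_addend m l f e s r d v 0 = 0"
| "prefix_addend m l f e s r d v (Suc u) =
     (of_int l ^ forward_sum e v (Suc u) * of_int (d v (Suc u))
      + of_int l ^ e (v + int u) * prefix_addend m l f e s r d v u
      - of_int (s (v + int (Suc u))) + of_int (r (v + int u)))
     / of_int m ^ f (v + int (Suc u))"

(* Digits and quotients exist and are unique, so that digit_expansion does define them when the
   radices are powers of m, or of l. *)

lemma digit_step:
  assumes x: "x \<in> Zfrac m l" and M: "M > 0"
    and cop: "\<And>q. coprime q m \<Longrightarrow> coprime q l \<Longrightarrow> coprime q M"
  shows "\<exists>y d. y \<in> Zfrac m l \<and> d \<in> {0..M - 1} \<and> x = of_int M * y + of_int d"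
proof -
  obtain p q where pq: "x = of_int p / of_int q" "q \<noteq> 0" "coprime q m" "coprime q l"
    using x by (auto simp: Zfrac_def)
  obtain t where t: "[q * t = 1] (mod M)"
    using cong_solve_coprime_int[OF cop[OF pq(3,4)]] by blast
  define d where "d = (p * t) mod M"
  have "[q * d = q * (p * t)] (mod M)"
    unfolding d_def by (simp add: cong_def mod_mult_right_eq)
  also have "q * (p * t) = p * (q * t)" by simp
  also have "[p * (q * t) = p * 1] (mod M)" using t by (rule cong_scalar_left)
  finally have "M dvd p - q * d" by (simp add: cong_iff_dvd_diff dvd_diff_commute)
  then obtain z where z: "p - q * d = M * z" by (elim dvdE)
  then have "p = M * z + q * d" by simp
  then have "x = of_int M * (of_int z / of_int q) + of_int d"
    using pq by (simp add: field_simps)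
  moreover have "of_int z / of_int q \<in> Zfrac m l" using pq by (auto simp: Zfrac_def)
  moreover have "d \<in> {0..M - 1}" using M by (simp add: d_def)
  ultimately show ?thesis by blast
qed

lemma digit_step_unique:
  assumes y: "y \<in> Zfrac m l" "y' \<in> Zfrac m l" and M: "M > 0"
    and cop: "\<And>q. coprime q m \<Longrightarrow> coprime q l \<Longrightarrow> coprime q M"
    and d: "d \<in> {0..M - 1}" "d' \<in> {0..M - 1}"
    and eq: "of_int M * y + of_int d = of_int M * y' + of_int d'"
  shows "y = y' \<and> d = d'"
proof -
  obtain p q where pq: "y = of_int p / of_int q" "q \<noteq> 0" "coprime q m" "coprime q l"
    using y by (auto simp: Zfrac_def)
  obtain p' q' where pq': "y' = of_int p' / of_int q'" "q' \<noteq> 0" "coprime q' m" "coprime q' l"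
    using y by (auto simp: Zfrac_def)
  have "rat_of_int (M * (p * q' - p' * q)) = of_int ((d' - d) * (q * q'))"
    using eq pq pq' by (simp add: field_simps)
  then have "M * (p * q' - p' * q) = (d' - d) * (q * q')" by (simp only: of_int_eq_iff)
  then have "M dvd (d' - d) * (q * q')" by (metis dvd_triv_left)
  moreover have "coprime M (q * q')"
    using cop[OF pq(3,4)] cop[OF pq'(3,4)] by (simp add: coprime_commute)
  ultimately have "M dvd d' - d" by (simp add: coprime_dvd_mult_left_iff)
  then have "d' mod M = d mod M" by (simp add: mod_eq_dvd_iff)
  then have "d = d'" using d by simp
  then show ?thesis using eq M by simp
qed

lemma digit_expansionD:
  assumes "digit_expansion R w x k d"
  shows "k 0 = x" "k u = of_int (w u) * k (Suc u) + of_int (d u)" "d u \<in> {0..w u - 1}"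
    "k (Suc u) \<in> R"
proof -
  note * = assms[unfolded digit_expansion_def]
  note ** = conjunct2[OF *, rule_format, of u]
  show "k 0 = x" by (rule conjunct1[OF *])
  show "k u = of_int (w u) * k (Suc u) + of_int (d u)" by (rule conjunct1[OF **])
  show "d u \<in> {0..w u - 1}" by (rule conjunct1[OF conjunct2[OF **]])
  show "k (Suc u) \<in> R" by (rule conjunct2[OF conjunct2[OF **]])
qed

lemma digit_expansion_exists:
  assumes x: "x \<in> Zfrac m l" and w: "\<And>u. w u > 0"
    and cop: "\<And>q u. coprime q m \<Longrightarrow> coprime q l \<Longrightarrow> coprime q (w u)"
  shows "\<exists>k d. digit_expansion (Zfrac m l) w x k d"
proof -
  have "\<forall>u y. \<exists>z c. y \<in> Zfrac m l \<longrightarrow>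
      z \<in> Zfrac m l \<and> c \<in> {0..w u - 1} \<and> y = of_int (w u) * z + of_int c"
  proof (intro allI)
    fix u y
    show "\<exists>z c. y \<in> Zfrac m l \<longrightarrow>
        z \<in> Zfrac m l \<and> c \<in> {0..w u - 1} \<and> y = of_int (w u) * z + of_int c"
    proof (cases "y \<in> Zfrac m l")
      case True
      have "\<exists>z c. z \<in> Zfrac m l \<and> c \<in> {0..w u - 1} \<and> y = of_int (w u) * z + of_int c"
        by (rule digit_step[OF True w]) (rule cop)
      then show ?thesis by (elim exE) (rule exI, rule exI, rule impI, assumption)
    qed simp
  qed
  then obtain K D where KD: "\<And>u y. y \<in> Zfrac m l \<Longrightarrow>
      K u y \<in> Zfrac m l \<and> D u y \<in> {0..w u - 1} \<and> y = of_int (w u) * K u y + of_int (D u y)"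
    by metis
  define k where "k = rec_nat x K"
  have k: "k 0 = x" "\<And>u. k (Suc u) = K u (k u)" by (simp_all add: k_def)
  have R: "k u \<in> Zfrac m l" for u
  proof (induction u)
    case 0 show ?case using x k(1) by simp
  next
    case (Suc u) then show ?case using KD[of "k u" u] k(2)[of u] by simp
  qed
  have "digit_expansion (Zfrac m l) w x k (\<lambda>u. D u (k u))"
    unfolding digit_expansion_def k(2)
  proof (intro conjI allI)
    fix u
    note KD' = KD[OF R, of u u]
    show "k 0 = x" by (rule k(1))
    show "k u = of_int (w u) * K u (k u) + of_int (D u (k u))"
      by (rule conjunct2[OF conjunct2[OF KD']])
    show "D u (k u) \<in> {0..w u - 1}" by (rule conjunct1[OF conjunct2[OF KD']])
    show "K u (k u) \<in> Zfrac m l" by (rule conjunct1[OF KD'])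
  qed
  then show ?thesis by blast
qed

lemma digit_expansion_unique:
  assumes w: "\<And>u. w u > 0"
    and cop: "\<And>q u. coprime q m \<Longrightarrow> coprime q l \<Longrightarrow> coprime q (w u)"
    and kd: "digit_expansion (Zfrac m l) w x k d" "digit_expansion (Zfrac m l) w x k' d'"
  shows "k = k' \<and> d = d'"
proof -
  have step: "k (Suc u) = k' (Suc u) \<and> d u = d' u" if "k u = k' u" for u
  proof (rule digit_step_unique[OF _ _ w cop])
    show "k (Suc u) \<in> Zfrac m l" "k' (Suc u) \<in> Zfrac m l"
      by (rule digit_expansionD(4)[OF kd(1)], rule digit_expansionD(4)[OF kd(2)])
    show "d u \<in> {0..w u - 1}" "d' u \<in> {0..w u - 1}"
      by (rule digit_expansionD(3)[OF kd(1)], rule digit_expansionD(3)[OF kd(2)])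
    show "of_int (w u) * k (Suc u) + of_int (d u)
        = of_int (w u) * k' (Suc u) + rat_of_int (d' u)"
      using that unfolding digit_expansionD(2)[OF kd(1), symmetric]
        digit_expansionD(2)[OF kd(2), symmetric] .
  qed
  have base: "k 0 = k' 0" by (simp only: digit_expansionD(1)[OF kd(1)] digit_expansionD(1)[OF kd(2)])
  have "k u = k' u" for u
  proof (induction u)
    case 0 show ?case by (rule base)
  next
    case (Suc u) then show ?case using step by blast
  qed
  with step show ?thesis by blast
qed

end

(* The quotients k of the m-adic expansions and j of the l-adic expansions agree along diagonals:
   j (v + u) u = k v u. Indeed the iteration rule reads n (v + 1) = l^(e v) * k v 1 + r v, so the
   carry c v u = k (v + 1) u - l^(e v) * k v (u + 1) starts at c v 0 = r v, which admissibility puts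
   in [0, l^(e v)), and the digit recursion of k gives
     m^(f (v + u + 1)) * c v (u + 1) = c v u - d (v + 1) u + l^(e v) * d v (u + 1).
   By induction c v u is an integer in [0, l^(e v)), hence it is the digit b (v + u + 1) u.
   The prefix addends telescope because Q v u = k (v + u) 1 - l^E * k v (u + 1), E = E_{v,u}. *)

theory Submission
  imports Defs
begin

section \<open>Closure and integrality in the ring \<open>Zfrac m l\<close>\<close>

lemma Zfrac_of_int: "of_int x \<in> Zfrac m l"
  unfolding Zfrac_def by (rule CollectI, intro exI[of _ x] exI[of _ 1]) simp

lemma Zfrac_mult:
  assumes "x \<in> Zfrac m l" "y \<in> Zfrac m l"
  shows "x * y \<in> Zfrac m l"
proof -
  obtain p q where x: "x = of_int p / of_int q" "q \<noteq> 0" "coprime q m" "coprime q l"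
    using assms(1) by (auto simp: Zfrac_def)
  obtain p' q' where y: "y = of_int p' / of_int q'" "q' \<noteq> 0" "coprime q' m" "coprime q' l"
    using assms(2) by (auto simp: Zfrac_def)
  have "x * y = of_int (p * p') / of_int (q * q')"
    using x(1) y(1) by simp
  moreover have "q * q' \<noteq> 0" "coprime (q * q') m" "coprime (q * q') l"
    using x y by simp_all
  ultimately show ?thesis unfolding Zfrac_def by blast
qed

lemma Zfrac_diff:
  assumes "x \<in> Zfrac m l" "y \<in> Zfrac m l"
  shows "x - y \<in> Zfrac m l"
proof -
  obtain p q where x: "x = of_int p / of_int q" "q \<noteq> 0" "coprime q m" "coprime q l"
    using assms(1) by (auto simp: Zfrac_def)
  obtain p' q' where y: "y = of_int p' / of_int q'" "q' \<noteq> 0" "coprime q' m" "coprime q' l"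
    using assms(2) by (auto simp: Zfrac_def)
  have "x - y = of_int (p * q' - p' * q) / of_int (q * q')"
    unfolding x(1) y(1) using x(2) y(2) by (simp add: diff_frac_eq)
  moreover have "q * q' \<noteq> 0" "coprime (q * q') m" "coprime (q * q') l"
    using x y by simp_all
  ultimately show ?thesis unfolding Zfrac_def by blast
qed

text \<open>The denominator is coprime to \<open>m\<close>, so a power of \<open>m\<close> cannot
  cancel it; it must divide the numerator. This makes the carries integers.\<close>

lemma Zfrac_integral:
  assumes "x \<in> Zfrac m l" and "of_int m ^ t * x = of_int N"
  shows "\<exists>c. x = of_int c"
proof -
  obtain p q where x: "x = of_int p / of_int q" "q \<noteq> 0" "coprime q m" "coprime q l"
    using assms(1) by (auto simp: Zfrac_def)
  have "rat_of_int (m ^ t * p) = of_int (q * N)"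
    using assms(2) x(1,2) by (simp add: field_simps)
  then have "m ^ t * p = q * N" by (simp only: of_int_eq_iff)
  then have "q dvd m ^ t * p" by simp
  moreover have "coprime q (m ^ t)" using x(3) by simp
  ultimately have "q dvd p" by (simp add: coprime_dvd_mult_right_iff)
  then obtain c where "p = q * c" by (elim dvdE)
  then have "x = of_int c" using x(1,2) by simp
  then show ?thesis ..
qed

section \<open>Index shifts and integer bounds\<close>

lemma forward_sum_Suc_shift: "forward_sum g v (Suc u) = g v + forward_sum g (v + 1) u"
  unfolding forward_sum_def by (simp add: sum.lessThan_Suc_shift algebra_simps del: sum.lessThan_Suc)

lemma backward_sum_eq_forward_sum: "backward_sum g (v + int u) u = forward_sum g v u"
proof -
  have "(\<Sum>y<u. g (v + int u - 1 - int y)) = (\<Sum>y<u. g (v + int (u - Suc y)))"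
    by (intro sum.cong refl arg_cong[of _ _ g]) auto
  then show ?thesis
    unfolding forward_sum_def backward_sum_def
    by (simp only: sum.nat_diff_reindex[of "\<lambda>y. g (v + int y)"])
qed

lemma periodic_fun_simple_mod:
  fixes g :: "int \<Rightarrow> 'a"
  assumes "periodic_fun_simple g \<tau>"
  shows "g (v mod \<tau>) = g v"
proof -
  interpret periodic_fun_simple g \<tau> by (rule assms)
  have "g (v mod \<tau> + of_int (v div \<tau>) * \<tau>) = g (v mod \<tau>)" by (rule plus_of_int)
  then show ?thesis by simp
qed

text \<open>The right-hand side exceeds \<open>- M\<close> and is at most
  \<open>(L - 1) + L * (M - 1) = M * L - 1\<close>, so dividing by \<open>M\<close> leaves
  \<open>C\<close> strictly between \<open>-1\<close> and \<open>L\<close>.\<close>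

lemma carry_bounds:
  fixes M L c D D' C :: int
  assumes "M * C = c - D' + L * D" "0 \<le> c" "c < L" "0 \<le> D" "D < M" "0 \<le> D'" "D' < M"
  shows "0 \<le> C \<and> C < L"
proof
  have "L * 0 \<le> L * D" using assms by (intro mult_left_mono) auto
  then have "M * (-1) < M * C" using assms by linarith
  then have "-1 < C" using assms by (subst (asm) mult_less_cancel_left_pos) auto
  then show "0 \<le> C" by simp
  have "L * D \<le> L * (M - 1)" using assms by (intro mult_left_mono) auto
  then have "L * D \<le> M * L - L" by (simp add: algebra_simps)
  then have "M * C < M * L" using assms by linarith
  then show "C < L" using assms by (subst (asm) mult_less_cancel_left_pos) auto
qed

text \<open>If \<open>r \<ge> L\<close>, then \<open>s \<le> M - 1\<close> forces
  \<open>a \<le> - L\<close>. The bound on \<open>a\<close> leaves room only for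
  \<open>r = L\<close>, where the equation makes \<open>L\<close> divide \<open>a\<close>.\<close>

lemma admissible_remainder_less:
  fixes M L s r a :: int
  assumes eq: "L * s = M * r + a" and s: "s \<le> M - 1" and pos: "0 < M" "0 < L"
    and bound: "\<bar>a\<bar> < max M L" and a: "\<not> L dvd a"
  shows "r < L"
proof (rule ccontr)
  assume "\<not> r < L"
  then have "M * L \<le> M * r" using pos by simp
  moreover have "L * s \<le> L * (M - 1)" using s pos by (intro mult_left_mono) auto
  ultimately have La: "L \<le> - a" using eq by (simp add: algebra_simps)
  have "- a \<noteq> L" using a by (metis dvd_refl dvd_minus_iff)
  \<comment> \<open>Since \<open>L \<le> - a\<close>, the maximum in the bound is \<open>M\<close>,
    so \<open>M * r = L * s - a < L * (M - 1) + M\<close>.\<close>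
  with La bound have "M * r < M * (L + 1)"
    using \<open>L * s \<le> L * (M - 1)\<close> eq pos by (simp add: algebra_simps)
  then have "r = L" using pos \<open>\<not> r < L\<close> by (simp add: mult_less_cancel_left_pos)
  with eq have "L dvd a" by (metis dvd_add_right_iff dvd_triv_left dvd_triv_right)
  with a show False ..
qed

text \<open>Every assumption holds at all integer indices, so indices can be shifted freely.
  Admissibility appears as ranges: \<open>s v\<close> is a remainder modulo \<open>m ^ f v\<close>,
  and \<open>r v\<close> one modulo \<open>l ^ e v\<close>.\<close>

locale graded_orbit =
  fixes m l :: int and f e :: "int \<Rightarrow> nat" and s r :: "int \<Rightarrow> int"
    and n :: "int \<Rightarrow> rat" and k j :: "int \<Rightarrow> nat \<Rightarrow> rat" and d b :: "int \<Rightarrow> nat \<Rightarrow> int"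
  assumes m_pos: "m > 0" and l_pos: "l > 0"
    and s_range: "s v \<in> {0..m ^ f v - 1}" and r_range: "r v \<in> {0..l ^ e v - 1}"
    and n_ring: "n v \<in> Zfrac m l"
    and n_cong: "cong_in (Zfrac m l) (n v) (of_int (s v)) (of_int m ^ f v)"
    and n_step: "n (v + 1) = of_int l ^ e v * ((n v - of_int (s v)) / of_int m ^ f v) + of_int (r v)"
    and m_digits: "digit_expansion (Zfrac m l) (\<lambda>u. m ^ f (v + int u)) (n v) (k v) (d v)"
    and l_digits: "digit_expansion (Zfrac m l) (\<lambda>u. l ^ e (v - 1 - int u)) (n v) (j v) (b v)"
begin

section \<open>Quotients and the first m-adic digit\<close>

lemma k_0: "k v 0 = n v"
  by (rule digit_expansionD(1)[OF m_digits])

lemma k_Suc: "k v u = of_int m ^ f (v + int u) * k v (Suc u) + of_int (d v u)"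
  using digit_expansionD(2)[OF m_digits, of v u] by simp

lemma d_range: "d v u \<in> {0..m ^ f (v + int u) - 1}"
  by (rule digit_expansionD(3)[OF m_digits])

lemma k_ring: "k v u \<in> Zfrac m l"
  using n_ring digit_expansionD(4)[OF m_digits] by (cases u) (auto simp: k_0)

text \<open>The congruence for \<open>n v\<close> is itself a division by \<open>m ^ f v\<close>
  with remainder \<open>s v\<close>, and such a division is unique.\<close>

lemma d_0: "d v 0 = s v"
proof -
  obtain z where z: "z \<in> Zfrac m l" "n v - of_int (s v) = of_int m ^ f v * z"
    using n_cong[of v] unfolding cong_in_def by blast
  have "k v (Suc 0) = z \<and> d v 0 = s v"
  proof (rule digit_step_unique)
    show "k v (Suc 0) \<in> Zfrac m l" "z \<in> Zfrac m l" by (rule k_ring, rule z(1))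
    show "m ^ f v > 0" using m_pos by simp
    show "coprime q (m ^ f v)" if "coprime q m" "coprime q l" for q using that by simp
    show "d v 0 \<in> {0..m ^ f v - 1}" using d_range[of v 0] by simp
    show "s v \<in> {0..m ^ f v - 1}" by (rule s_range)
    show "of_int (m ^ f v) * k v (Suc 0) + of_int (d v 0) = of_int (m ^ f v) * z + of_int (s v)"
      using k_Suc[of v 0] z(2) by (simp add: k_0 algebra_simps)
  qed
  then show ?thesis ..
qed

lemma k_1: "k v (Suc 0) = (n v - of_int (s v)) / of_int m ^ f v"
  using k_Suc[of v 0] m_pos by (simp add: k_0 d_0 field_simps)

lemma n_eq_k_1: "n (v + 1) = of_int l ^ e v * k v (Suc 0) + of_int (r v)"
  unfolding k_1 by (rule n_step)

section \<open>Carries between neighbouring expansions, and diagonals\<close>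

definition carry :: "int \<Rightarrow> nat \<Rightarrow> rat" where
  "carry v u = k (v + 1) u - of_int l ^ e v * k v (Suc u)"

lemma carry_ring: "carry v u \<in> Zfrac m l"
  unfolding carry_def
  by (intro Zfrac_diff Zfrac_mult k_ring) (metis Zfrac_of_int of_int_power)

lemma carry_0: "carry v 0 = of_int (r v)"
  by (simp add: carry_def k_0 n_eq_k_1)

text \<open>Place \<open>u\<close> of the expansion at \<open>v + 1\<close> and place
  \<open>Suc u\<close> of the one at \<open>v\<close> have the same radix, so their digit recursions
  can be subtracted.\<close>

lemma carry_Suc:
  "of_int m ^ f (v + int (Suc u)) * carry v (Suc u)
    = carry v u - of_int (d (v + 1) u) + of_int l ^ e v * of_int (d v (Suc u))"
proof -
  have "v + 1 + int u = v + int (Suc u)" by simp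
  then show ?thesis
    unfolding carry_def k_Suc[of "v + 1" u] k_Suc[of v "Suc u"] by (simp add: algebra_simps)
qed

lemma carry_digit: "\<exists>c \<in> {0..l ^ e v - 1}. carry v u = of_int c"
proof (induction u)
  case 0
  then show ?case using r_range carry_0 by blast
next
  case (Suc u)
  then obtain c where c: "c \<in> {0..l ^ e v - 1}" "carry v u = of_int c" by blast
  define N where "N = c - d (v + 1) u + l ^ e v * d v (Suc u)"
  have N: "of_int m ^ f (v + int (Suc u)) * carry v (Suc u) = of_int N"
    unfolding carry_Suc c(2) N_def by simp
  obtain C where C: "carry v (Suc u) = of_int C"
    \<comment> \<open>Integrality has to precede the bounds, which concern integers only.\<close>
    using Zfrac_integral[OF carry_ring N] by blast
  have "rat_of_int (m ^ f (v + int (Suc u)) * C) = of_int N"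
    using N unfolding C by simp
  then have "m ^ f (v + int (Suc u)) * C = N" by (simp only: of_int_eq_iff)
  moreover have idx: "v + 1 + int u = v + int (Suc u)" by simp
  ultimately have "0 \<le> C \<and> C < l ^ e v"
    using c(1) d_range[of v "Suc u"] d_range[of "v + 1" u, unfolded idx] unfolding N_def
    by (intro carry_bounds[of "m ^ f (v + int (Suc u))" C c "d (v + 1) u" _ "d v (Suc u)"]) simp_all
  with C show ?case by (intro bexI[of _ C]) auto
qed

text \<open>By \<open>carry_digit\<close>, the definition of \<open>carry\<close> reads as a
  division of \<open>k (v + 1) u\<close> by \<open>l ^ e v\<close> with remainder
  \<open>carry v u\<close>. The l-adic expansion divides the same number by the same radix, so
  uniqueness applies.\<close>

lemma j_diagonal_step:
  assumes "j (v + int u + 1) u = k (v + 1) u"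
  shows "j (v + int u + 1) (Suc u) = k v (Suc u) \<and> of_int (b (v + int u + 1) u) = carry v u"
proof -
  obtain c where c: "c \<in> {0..l ^ e v - 1}" "carry v u = of_int c"
    using carry_digit by blast
  note exp = l_digits[of "v + int u + 1"]
  have idx: "v + int u + 1 - 1 - int u = v" by simp
  have "j (v + int u + 1) (Suc u) = k v (Suc u) \<and> b (v + int u + 1) u = c"
  proof (rule digit_step_unique)
    show "j (v + int u + 1) (Suc u) \<in> Zfrac m l" by (rule digit_expansionD(4)[OF exp])
    show "k v (Suc u) \<in> Zfrac m l" by (rule k_ring)
    show "l ^ e v > 0" using l_pos by simp
    show "coprime q (l ^ e v)" if "coprime q m" "coprime q l" for q using that by simp
    show "b (v + int u + 1) u \<in> {0..l ^ e v - 1}"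
      using digit_expansionD(3)[OF exp, of u] unfolding idx .
    show "c \<in> {0..l ^ e v - 1}" by (rule c(1))
    show "of_int (l ^ e v) * j (v + int u + 1) (Suc u) + of_int (b (v + int u + 1) u)
        = of_int (l ^ e v) * k v (Suc u) + of_int c"
      using digit_expansionD(2)[OF exp, of u] assms c(2) unfolding idx carry_def by simp
  qed
  with c(2) show ?thesis by simp
qed

lemma j_diagonal: "j (v + int u) u = k v u"
\<comment> \<open>The index \<open>v\<close> varies because the step for \<open>v\<close> uses the
  hypothesis at \<open>v + 1\<close>.\<close>
proof (induction u arbitrary: v)
  case 0
  show ?case using digit_expansionD(1)[OF l_digits] by (simp add: k_0)
next
  case (Suc u)
  have "j (v + int u + 1) u = k (v + 1) u" using Suc[of "v + 1"] by (simp add: algebra_simps)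
  from j_diagonal_step[OF this] show ?case by (simp add: algebra_simps)
qed

lemma b_eq_carry: "of_int (b (v + int u + 1) u) = carry v u"
  using j_diagonal_step[of v u] j_diagonal[of "v + 1" u] by (simp add: algebra_simps)

section \<open>Prefix addends and the digit formula\<close>

lemma prefix_addend_eq:
  "prefix_addend m l f e s r d v u
    = k (v + int u) (Suc 0) - of_int l ^ forward_sum e v u * k v (Suc u)"
proof (induction u)
  case 0
  show ?case by (simp add: forward_sum_def)
next
  case (Suc u)
  define w where "w = v + int (Suc u)"
  have w: "v + int u + 1 = w" by (simp add: w_def)
  have E: "forward_sum e v (Suc u) = forward_sum e v u + e (v + int u)"
    by (simp add: forward_sum_def)
  have "n w = of_int l ^ e (v + int u) * k (v + int u) (Suc 0) + of_int (r (v + int u))"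
    using n_eq_k_1[of "v + int u"] unfolding w .
  moreover have "n w = of_int m ^ f w * k w (Suc 0) + of_int (s w)"
    using k_Suc[of w 0] by (simp add: k_0 d_0)
  moreover have "k v (Suc u) = of_int m ^ f w * k v (Suc (Suc u)) + of_int (d v (Suc u))"
    using k_Suc[of v "Suc u"] unfolding w_def .
  \<comment> \<open>The two expressions for \<open>n w\<close> reduce the part with \<open>r\<close>
    and \<open>s\<close> to \<open>m ^ f w * k w 1\<close>; the third identity leaves
    \<open>m ^ f w\<close> times the new quotient of \<open>n v\<close>. The factor
    \<open>m ^ f w\<close> then cancels.\<close>
  ultimately show ?case
    unfolding prefix_addend.simps Suc.IH E w_def[symmetric]
    using m_pos by (simp add: power_add field_simps)
qed

text \<open>Both closed forms contain the same term \<open>k (v + int (Suc u)) 1\<close>, which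
  cancels. Factoring out the common power of \<open>l\<close> leaves
  \<open>carry v (Suc u)\<close>.\<close>

lemma prefix_addend_diff:
  "prefix_addend m l f e s r d v (Suc u) - prefix_addend m l f e s r d (v + 1) u
    = of_int l ^ backward_sum e (v + int (Suc u)) u * of_int (b (v + int (Suc u) + 1) (Suc u))"
proof -
  have idx: "v + 1 + int u = v + int (Suc u)" by simp
  have "backward_sum e (v + int (Suc u)) u = forward_sum e (v + 1) u"
    using backward_sum_eq_forward_sum[of e "v + 1" u] unfolding idx .
  then show ?thesis
    unfolding b_eq_carry carry_def prefix_addend_eq idx forward_sum_Suc_shift
    by (simp add: power_add algebra_simps)
qed

lemma b_Suc:
  "of_int (b (v + int (Suc u) + 1) (Suc u))
    = (of_int l ^ e v * of_int (d v (Suc u)) - of_int (d (v + 1) u)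
        + of_int (b (v + int (Suc u)) u)) / (of_int m ^ f (v + int (Suc u)) :: rat)"
proof -
  have "rat_of_int (b (v + int (Suc u)) u) = carry v u"
    using b_eq_carry[of v u] by (simp add: algebra_simps)
  then show ?thesis
    unfolding b_eq_carry using carry_Suc[of v u] m_pos by (simp add: field_simps)
qed

end

theorem theorem4p1:
  fixes m l \<tau> :: int
    and f e :: "int \<Rightarrow> nat"
    and a :: "int \<Rightarrow> int \<Rightarrow> int"
    and i s r :: "int \<Rightarrow> int"
    and n :: "int \<Rightarrow> rat"
    and k j :: "int \<Rightarrow> nat \<Rightarrow> rat"
    and d b :: "int \<Rightarrow> nat \<Rightarrow> int"
  assumes ml: "m \<ge> 2" "l \<ge> 2" "coprime m l" and tau: "\<tau> \<ge> 1"
    and per: "periodic_fun_simple f \<tau>" "periodic_fun_simple e \<tau>"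
      "periodic_fun_simple s \<tau>" "periodic_fun_simple r \<tau>"
    and f_pos: "\<forall>v\<in>{0..\<tau> - 1}. f v > 0"
    and a_zero: "\<forall>v\<in>{0..\<tau> - 1}. a v 0 = 0"
    and a_nonzero: "\<forall>v\<in>{0..\<tau> - 1}. \<forall>h\<in>{1..l - 1}.
      [a v h = - (m ^ f v * h)] (mod l) \<and> [a v h \<noteq> 0] (mod m) \<and> [a v h \<noteq> 0] (mod l)"
    and i_range: "\<forall>v\<in>{0..\<tau> - 1}. i v \<in> {1..l - 1}"
    and s_adm: "\<forall>v\<in>{0..\<tau> - 1}. 1 \<le> s v \<and> s v \<le> m ^ f v - 1 \<and> gcd (s v) m = 1"
    and er_pos: "\<forall>v\<in>{0..\<tau> - 1}. e v > 0 \<and> r v > 0"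
    and r_cong: "\<forall>v\<in>{0..\<tau> - 1}. [r v = i v] (mod l)"
    and adm_eq: "\<forall>v\<in>{0..\<tau> - 1}. l ^ e v * s v = m ^ f v * r v + a v (i v)"
    and adm_bound: "\<forall>v\<in>{0..\<tau> - 1}. \<bar>a v (i v)\<bar> < max (m ^ f v) (l ^ e v)"
    and n_ring: "\<forall>v. n v \<in> Zfrac m l" and n_per: "periodic_fun_simple n \<tau>"
    and n_cong: "\<forall>v. cong_in (Zfrac m l) (n v) (of_int (s v)) (of_int m ^ f v)"
    and n_step: "\<forall>v. n (v + 1) =
      of_int l ^ e v * ((n v - of_int (s v)) / of_int m ^ f v) + of_int (r v)"
    and m_digits: "\<forall>v. digit_expansion (Zfrac m l) (\<lambda>u. m ^ f (v + int u)) (n v) (k v) (d v)"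
    and l_digits: "\<forall>v. digit_expansion (Zfrac m l) (\<lambda>u. l ^ e (v - 1 - int u)) (n v) (j v) (b v)"
  shows "\<forall>v\<in>{0..\<tau> - 1}. \<forall>u::nat. u \<ge> 1 \<longrightarrow>
    prefix_addend m l f e s r d v u - prefix_addend m l f e s r d (v + 1) (u - 1)
      = of_int l ^ backward_sum e (v + int u) (u - 1) * of_int (b (v + int u + 1) u) \<and>
    of_int (b (v + int u + 1) u)
      = (of_int l ^ e v * of_int (d v u) - of_int (d (v + 1) (u - 1)) + of_int (b (v + int u) (u - 1)))
        / (of_int m ^ f (v + int u) :: rat)"
proof -
  have base: "s v \<in> {0..m ^ f v - 1} \<and> r v \<in> {0..l ^ e v - 1}" if v: "v \<in> {0..\<tau> - 1}" for v
  proof -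
    have s: "1 \<le> s v" "s v \<le> m ^ f v - 1" using s_adm v by auto
    have er: "e v > 0" "r v > 0" using er_pos v by auto
    have "\<not> l dvd a v (i v)"
      using bspec[OF bspec[OF a_nonzero v] bspec[OF i_range v]] by (simp add: cong_0_iff)
    \<comment> \<open>Positivity of \<open>e v\<close> lifts non-divisibility by \<open>l\<close> to
      the full radix \<open>l ^ e v\<close>.\<close>
    moreover have "l dvd l ^ e v" using er(1) by simp
    ultimately have "\<not> l ^ e v dvd a v (i v)" using dvd_trans by blast
    then have "r v < l ^ e v"
      using admissible_remainder_less[of "l ^ e v" "s v" "m ^ f v" "r v" "a v (i v)"]
        bspec[OF adm_eq v] bspec[OF adm_bound v] s(2) ml by simp
    then show ?thesis using s er by auto
  qed
  have "s v \<in> {0..m ^ f v - 1} \<and> r v \<in> {0..l ^ e v - 1}" for v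
  proof -
    \<comment> \<open>Periodicity carries the ranges from one period to all integers, as the locale
      requires.\<close>
    have "v mod \<tau> \<in> {0..\<tau> - 1}" using tau by simp
    from base[OF this] show ?thesis by (simp only: per[THEN periodic_fun_simple_mod])
  qed
  then interpret graded_orbit m l f e s r n k j d b
    using ml n_ring n_cong n_step m_digits l_digits by unfold_locales auto
  show ?thesis
  proof (intro ballI allI impI)
    fix v :: int and u :: nat
    assume "u \<ge> 1"
    then obtain u' where u: "u = Suc u'" by (cases u) auto
    show "prefix_addend m l f e s r d v u - prefix_addend m l f e s r d (v + 1) (u - 1)
        = of_int l ^ backward_sum e (v + int u) (u - 1) * of_int (b (v + int u + 1) u) \<and>
      of_int (b (v + int u + 1) u)
        = (of_int l ^ e v * of_int (d v u) - of_int (d (v + 1) (u - 1))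
            + of_int (b (v + int u) (u - 1))) / (of_int m ^ f (v + int u) :: rat)"
      unfolding u diff_Suc_1 by (intro conjI prefix_addend_diff b_Suc)
  qed
qed

end
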